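(* Let $p=1/2$. There is a constant $C>0$ such that for every $\varepsilon\in(0,1)$ there is a search algorithm which finds a path of length $n$ from the root having at least $(1-\varepsilon)n$ ones, in time at most $Cn\varepsilon^{-1}$, with probability tending to $1$ as $n\to\infty$.
   Context: Let $T$ be the infinite rooted binary tree (each vertex has exactly two children) with root $\mathbf{0}$. Write $|v|$ for the depth of $v$ (distance from the root) and $w\le v$ if $w$ equals $v$ or is an ancestor of $v$. The labels $\{X(v):v\in T\}$ are IID Bernoulli random variables with mean $p$. Put $S(v)=\sum_{\mathbf{0}<w\le v}X(w)$, the number of ones along the path from the root to $v$ (so $S(\mathbf{0})=0$). A search algorithm (possibly randomized, using randomness independent of the labels) examines one vertex $v(t)$ at each time $t=1,2,\ldots$ and learns $X(v(t))$; the choice of $v(t)$ may depend only on the information obtained before time $t$ (and the auxiliary randomness). A path from the root to a vertex $v$ with $|v|=n$ is found by time $t$ if every $w$ with $\mathbf{0}<w\le v$ is among the vertices examined at times at most $t$; it has at least $(1-\varepsilon)n$ ones if $S(v)\ge(1-\varepsilon)n$. *)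

theory Defs
  imports "HOL-Probability.Probability" "HOL-Library.Sublist"
begin

text \<open>
  A vertex of the binary tree is the list of left/right choices leading to it from the root \<open>[]\<close>:
  the children of \<open>v\<close> are \<open>v @ [False]\<close> and \<open>v @ [True]\<close>, the depth of \<open>v\<close> is \<open>length v\<close>, and
  \<open>w \<le> v\<close> in the tree order is \<open>prefix w v\<close>.
\<close>

type_synonym vertex = "bool list"

text \<open>A labelling of the tree; the value \<open>True\<close> is the label 1 and \<open>False\<close> is the label 0.\<close>

type_synonym labelling = "vertex \<Rightarrow> bool"

definition label_measure :: "real \<Rightarrow> labelling measure" where
  "label_measure p = PiM UNIV (\<lambda>_. measure_pmf (bernoulli_pmf p))"

definition path_ones :: "labelling \<Rightarrow> vertex \<Rightarrow> nat" where
  "path_ones X v = (\<Sum>w | w \<noteq> [] \<and> prefix w v. of_bool (X w))"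

text \<open>
  The vertices examined so far with the labels they revealed, oldest first. A strategy maps such
  a history to the vertex it examines next. There is no adjacency requirement, and a vertex may
  be examined again at the cost of a unit of time.
\<close>

type_synonym history = "(vertex \<times> bool) list"

type_synonym strategy = "history \<Rightarrow> vertex"

primrec history_at :: "strategy \<Rightarrow> labelling \<Rightarrow> nat \<Rightarrow> history" where
  "history_at a X 0 = []"
| "history_at a X (Suc t) =
     (let h = history_at a X t; v = a h in h @ [(v, X v)])"

text \<open>The vertex $v(t)$; meaningful for \<open>t \<ge> 1\<close> only.\<close>

definition examined :: "strategy \<Rightarrow> labelling \<Rightarrow> nat \<Rightarrow> vertex" where
  "examined a X t = a (history_at a X (t - 1))"

definition path_found_by :: "strategy \<Rightarrow> labelling \<Rightarrow> vertex \<Rightarrow> real \<Rightarrow> bool" where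
  "path_found_by a X v \<tau> \<longleftrightarrow>
     (\<forall>w. w \<noteq> [] \<and> prefix w v \<longrightarrow> (\<exists>t\<ge>1. real t \<le> \<tau> \<and> examined a X t = w))"

text \<open>
  A randomized algorithm draws a seed \<open>r\<close> from \<open>R\<close> and then follows the strategy \<open>A r\<close>. Since there
  are only countably many histories, measurability for each fixed history gives joint
  measurability. The seed is independent of the labels because the two are combined in the product
  measure \<open>R \<Otimes>\<^sub>M label_measure p\<close>.
\<close>

definition search_algorithm :: "'r measure \<Rightarrow> ('r \<Rightarrow> strategy) \<Rightarrow> bool" where
  "search_algorithm R A \<longleftrightarrow>
     prob_space R \<and> (\<forall>h. (\<lambda>r. A r h) \<in> measurable R (count_space UNIV))"

definition success_probability ::
    "real \<Rightarrow> 'r measure \<Rightarrow> ('r \<Rightarrow> strategy) \<Rightarrow> real \<Rightarrow> nat \<Rightarrow> real \<Rightarrow> real" where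
  "success_probability p R A \<epsilon> n \<tau> =
     \<P>(\<omega> in R \<Otimes>\<^sub>M label_measure p.
        \<exists>v. length v = n \<and> real (path_ones (snd \<omega>) v) \<ge> (1 - \<epsilon>) * real n
            \<and> path_found_by (A (fst \<omega>)) (snd \<omega>) v \<tau>)"

end

theory Submission
  imports Defs "HOL-Real_Asymp.Real_Asymp"
begin

text \<open>
  At \<open>p = 1/2\<close> the vertices joined to their ancestor by a run of ones form a critical branching process,
  so an all-ones path of length \<open>M\<close> is met with probability of order \<open>1/M\<close> only. If the label is ignored
  at every depth divisible by \<open>M\<close>, the resulting process (blocks of \<open>M\<close> levels, each block with at most
  one zero) is supercritical and survives with probability at least of order \<open>1/M\<close> from every vertex.
  The search is a depth-first search of this process with \<open>M\<close> about \<open>2/\<epsilon>\<close>: heuristically, a fraction of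
  order \<open>1/M\<close> of the vertices it visits survive, these all lie on the path that is eventually followed,
  and so \<open>n\<close> levels cost a time of order \<open>n M\<close>, that is \<open>n/\<epsilon>\<close>. The path has a zero at one level in
  \<open>M\<close>, hence about \<open>\<epsilon> n / 2\<close> zeros.

  No survival event occurs in the proof. Instead, explicit lower bounds \<open>win d\<close> for the survival
  probability at depth \<open>d\<close> are used as weights: imagine that the vertices on the stack of the search,
  from the top downwards, win independently with these probabilities, and let the potential be the
  expected depth of the first winner. Except at the end of a block (see below), visiting a vertex of depth \<open>d\<close> replaces it by no vertex or by two
  vertices of depth \<open>d + 1\<close>. The weights are chosen so that the chance of a win at that place does
  not decrease on average, while the depth of such a win grows by one; the potential therefore gains at
  least \<open>win d \<ge> 1/(2M)\<close> in expectation (lemma \<open>potential_drift\<close>).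

  To pass from expectation to high probability the increments must be bounded. For this the stack is
  cleared whenever a depth divisible by \<open>B = M N\<close> is reached, and the search restarts below the last
  visited vertex if the stack becomes empty. A restart leaves one more zero on the path, and
  this is charged \<open>N/2\<close> in the potential. A linear lower bound on the potential then shows both that the
  search is deep and that there were few restarts; \<open>N\<close> of order \<open>\<epsilon>\<^sup>2\<close> inverse makes their number at most
  \<open>\<epsilon> n / 2\<close>.

  The search never visits a vertex twice, so the labels it sees are independent fair bits, whatever
  its choices (lemma \<open>prob_bits\<close>). The state after \<open>t\<close> steps is a function of these bits, and the
  probability of a small potential is estimated by summing an exponential of the potential over all
  bit strings of length \<open>t\<close> (lemma \<open>drift_lower_tail\<close>).
\<close>

section \<open>Chains with bounded increments and positive drift\<close>

lemma exp_minus_le_quadratic: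
  fixes x :: real
  assumes "\<bar>x\<bar> \<le> 1"
  shows "exp (- x) \<le> 1 - x + x\<^sup>2"
proof (cases "x \<ge> 0")
  case True
  have "1 \<le> (1 - x + x\<^sup>2) * (1 + x + x\<^sup>2 / 2)"
  proof -
    have "(1 - x + x\<^sup>2) * (1 + x + x\<^sup>2 / 2) = 1 + (x^2 + x^3 + x^4) / 2"
      by (simp add: algebra_simps add_divide_distrib diff_divide_distrib
          power2_eq_square power3_eq_cube power4_eq_xxxx)
    then show ?thesis using True by simp
  qed
  also have "\<dots> \<le> (1 - x + x\<^sup>2) * exp x"
    using exp_lower_Taylor_quadratic[OF True] True assms
    by (intro mult_left_mono) auto
  finally show ?thesis
    by (simp add: exp_minus field_simps)
next
  case False
  then show ?thesis using exp_bound[of "- x"] assms by auto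
qed

lemma sum_bool_lists_Suc:
  fixes g :: "bool list \<Rightarrow> 'b::comm_monoid_add"
  shows "(\<Sum>bs | length bs = Suc t. g bs) =
    (\<Sum>bs | length bs = t. g (True # bs)) + (\<Sum>bs | length bs = t. g (False # bs))"
proof -
  let ?S = "{bs::bool list. length bs = t}"
  have fin: "finite ?S" using finite_lists_length_eq[of "UNIV::bool set" t] by simp
  have eq: "{bs. length bs = Suc t} = Cons True ` ?S \<union> Cons False ` ?S"
    by (auto simp: length_Suc_conv image_iff)
  have "sum g (Cons True ` ?S \<union> Cons False ` ?S) = sum g (Cons True ` ?S) + sum g (Cons False ` ?S)"
    using fin by (intro sum.union_disjoint) auto
  then show ?thesis by (simp add: eq sum.reindex)
qed

text \<open>
  For small \<open>\<theta>\<close> the gain \<open>\<theta> \<delta>\<close> from the drift beats the quadratic error \<open>(\<theta> K)\<^sup>2\<close>, so that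
  \<open>exp (- \<theta> \<Phi>)\<close> contracts by a constant factor per fair bit; the chosen \<open>\<theta>\<close> makes the error half of the
  gain. Expectation over \<open>t\<close> fair bits appears as a sum over bit strings without the normalisation
  \<open>2 ^ t\<close>.
\<close>

lemma drift_exp_moment:
  fixes \<Phi> :: "'s \<Rightarrow> real"
  assumes inv: "\<And>s b. I s \<Longrightarrow> I (step s b)"
    and drift: "\<And>s. I s \<Longrightarrow> \<Phi> (step s True) + \<Phi> (step s False) \<ge> 2 * (\<Phi> s + \<delta>)"
    and bdd: "\<And>s b. I s \<Longrightarrow> \<bar>\<Phi> (step s b) - \<Phi> s\<bar> \<le> K"
    and \<delta>: "0 < \<delta>" "\<delta> \<le> K"
    and \<theta>: "\<theta> = \<delta> / (2 * K\<^sup>2)"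
    and "I s"
  shows "(\<Sum>bs | length bs = t. exp (- \<theta> * \<Phi> (foldl step s bs)))
           \<le> (2 * exp (- (\<theta> * \<delta> / 2))) ^ t * exp (- \<theta> * \<Phi> s)"
  using \<open>I s\<close>
proof (induction t arbitrary: s)
  case 0
  have "{bs::bool list. length bs = 0} = {[]}" by auto
  then show ?case by simp
next
  case (Suc t)
  define E where "E = (2 * exp (- (\<theta> * \<delta> / 2))) ^ t"
  have K: "K > 0" using \<delta> by simp
  have \<theta>0: "\<theta> > 0" using \<delta> K by (simp add: \<theta>)
  have \<theta>K: "\<theta> * K \<le> 1" using \<delta> K by (simp add: \<theta> power2_eq_square field_simps)
  have \<theta>K2: "(\<theta> * K)\<^sup>2 = \<theta> * \<delta> / 2" using K by (simp add: \<theta> power2_eq_square field_simps)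
  have one: "exp (- \<theta> * \<Phi> (step s b)) \<le> exp (- \<theta> * \<Phi> s) * (1 - \<theta> * (\<Phi> (step s b) - \<Phi> s) + \<theta> * \<delta> / 2)" for b
  proof -
    let ?x = "\<theta> * (\<Phi> (step s b) - \<Phi> s)"
    have x: "\<bar>?x\<bar> \<le> \<theta> * K"
      using bdd[OF Suc.prems, of b] \<theta>0 by (simp add: abs_mult)
    have "?x\<^sup>2 \<le> \<theta> * \<delta> / 2"
      using power_mono[OF x, of 2] \<theta>K2 by simp
    moreover have "exp (- ?x) \<le> 1 - ?x + ?x\<^sup>2"
      using x \<theta>K by (intro exp_minus_le_quadratic) linarith
    ultimately have "exp (- ?x) \<le> 1 - ?x + \<theta> * \<delta> / 2" by linarith
    from mult_left_mono[OF this, of "exp (- \<theta> * \<Phi> s)"] show ?thesis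
      by (simp add: exp_add[symmetric] algebra_simps)
  qed
  have "(\<Sum>bs | length bs = Suc t. exp (- \<theta> * \<Phi> (foldl step s bs)))
      \<le> E * exp (- \<theta> * \<Phi> (step s True)) + E * exp (- \<theta> * \<Phi> (step s False))"
    unfolding sum_bool_lists_Suc foldl_Cons
    using Suc.IH[OF inv[OF Suc.prems, of True]] Suc.IH[OF inv[OF Suc.prems, of False]]
    unfolding E_def by (intro add_mono)
  also have "\<dots> = E * (exp (- \<theta> * \<Phi> (step s True)) + exp (- \<theta> * \<Phi> (step s False)))"
    by (simp add: algebra_simps)
  also have "\<dots> \<le> E * (exp (- \<theta> * \<Phi> s) *
      (2 - \<theta> * (\<Phi> (step s True) + \<Phi> (step s False) - 2 * \<Phi> s) + \<theta> * \<delta>))"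
    using one[of True] one[of False]
    by (intro mult_left_mono) (simp_all add: E_def algebra_simps)
  also have "\<dots> \<le> E * (exp (- \<theta> * \<Phi> s) * (2 * (1 + (- (\<theta> * \<delta> / 2)))))"
  proof -
    have "\<theta> * (2 * \<delta>) \<le> \<theta> * (\<Phi> (step s True) + \<Phi> (step s False) - 2 * \<Phi> s)"
      using drift[OF Suc.prems] \<theta>0 by (intro mult_left_mono) auto
    then show ?thesis by (intro mult_left_mono) (auto simp: E_def algebra_simps)
  qed
  also have "\<dots> \<le> E * (exp (- \<theta> * \<Phi> s) * (2 * exp (- (\<theta> * \<delta> / 2))))"
    by (intro mult_left_mono exp_ge_add_one_self) (auto simp: E_def)
  also have "\<dots> = (2 * exp (- (\<theta> * \<delta> / 2))) ^ Suc t * exp (- \<theta> * \<Phi> s)"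
    by (simp add: E_def mult_ac)
  finally show ?case .
qed

text \<open>
  Markov's inequality for \<open>exp (- \<theta> \<Phi>)\<close>: half of the exponential rate is spent on the threshold
  \<open>\<delta> t / 4\<close>, the other half remains.
\<close>

lemma drift_lower_tail:
  fixes \<Phi> :: "'s \<Rightarrow> real"
  assumes inv: "\<And>s b. I s \<Longrightarrow> I (step s b)"
    and drift: "\<And>s. I s \<Longrightarrow> \<Phi> (step s True) + \<Phi> (step s False) \<ge> 2 * (\<Phi> s + \<delta>)"
    and bdd: "\<And>s b. I s \<Longrightarrow> \<bar>\<Phi> (step s b) - \<Phi> s\<bar> \<le> K"
    and \<delta>: "0 < \<delta>" "\<delta> \<le> K"
    and "I s"
  obtains a c where "a > 0" "c > 0" and "\<And>t.
    real (card {bs. length bs = t \<and> \<Phi> (foldl step s bs) < \<delta> / 4 * t}) / 2 ^ t \<le> a * exp (- c * t)"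
proof
  define \<theta> where "\<theta> = \<delta> / (2 * K\<^sup>2)"
  have \<theta>0: "\<theta> > 0" using \<delta> by (simp add: \<theta>_def)
  show "exp (- \<theta> * \<Phi> s) > 0" by simp
  show "\<theta> * \<delta> / 4 > 0" using \<theta>0 \<delta> by simp
  fix t :: nat
  let ?S = "{bs::bool list. length bs = t}"
  let ?T = "{bs. length bs = t \<and> \<Phi> (foldl step s bs) < \<delta> / 4 * t}"
  have fin: "finite ?S" using finite_lists_length_eq[of "UNIV::bool set" t] by simp
  have "card ?T * exp (- (\<theta> * \<delta> / 4 * t)) = (\<Sum>bs\<in>?T. exp (- (\<theta> * \<delta> / 4 * t)))" by simp
  also have "\<dots> \<le> (\<Sum>bs\<in>?T. exp (- \<theta> * \<Phi> (foldl step s bs)))"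
  proof (intro sum_mono)
    fix bs assume "bs \<in> ?T"
    then have "\<theta> * \<Phi> (foldl step s bs) \<le> \<theta> * (\<delta> / 4 * t)"
      using \<theta>0 by (intro mult_left_mono) auto
    then show "exp (- (\<theta> * \<delta> / 4 * t)) \<le> exp (- \<theta> * \<Phi> (foldl step s bs))" by simp
  qed
  also have "\<dots> \<le> (\<Sum>bs\<in>?S. exp (- \<theta> * \<Phi> (foldl step s bs)))"
    using fin by (intro sum_mono2) auto
  also have "\<dots> \<le> (2 * exp (- (\<theta> * \<delta> / 2))) ^ t * exp (- \<theta> * \<Phi> s)"
    by (rule drift_exp_moment[where I = I and K = K]) (use assms \<theta>_def in auto)
  also have "exp (- (\<theta> * \<delta> / 2)) = exp (- (\<theta> * \<delta> / 4)) * exp (- (\<theta> * \<delta> / 4))"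
    by (simp add: exp_add[symmetric])
  also have "(2 * (exp (- (\<theta> * \<delta> / 4)) * exp (- (\<theta> * \<delta> / 4)))) ^ t * exp (- \<theta> * \<Phi> s)
      = 2 ^ t * (exp (- \<theta> * \<Phi> s) * exp (- (\<theta> * \<delta> / 4) * t)) * exp (- (\<theta> * \<delta> / 4 * t))"
    by (simp add: power_mult_distrib exp_of_nat2_mult[symmetric])
  finally have "real (card ?T) \<le> 2 ^ t * (exp (- \<theta> * \<Phi> s) * exp (- (\<theta> * \<delta> / 4) * t))" by simp
  then show "real (card ?T) / 2 ^ t \<le> exp (- \<theta> * \<Phi> s) * exp (- (\<theta> * \<delta> / 4) * t)"
    by (simp add: field_simps)
qed

section \<open>Strategies that never repeat a vertex see fair bits\<close>

text \<open>
  The history that a strategy produces when the successive answers are the given bits, whatever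
  labelling they come from.
\<close>

definition replay :: "strategy \<Rightarrow> bool list \<Rightarrow> history" where
  "replay a bs = foldl (\<lambda>h b. h @ [(a h, b)]) [] bs"

lemma replay_Nil [simp]: "replay a [] = []"
  by (simp add: replay_def)

lemma replay_snoc [simp]: "replay a (bs @ [b]) = replay a bs @ [(a (replay a bs), b)]"
  by (simp add: replay_def)

lemma length_replay [simp]: "length (replay a bs) = length bs"
  by (induction bs rule: rev_induct) auto

lemma map_snd_replay [simp]: "map snd (replay a bs) = bs"
  by (induction bs rule: rev_induct) auto

lemma length_history_at [simp]: "length (history_at a X t) = t"
  by (induction t) (auto simp: Let_def)

lemma history_at_eq_replay: "history_at a X t = replay a (map snd (history_at a X t))"
  by (induction t) (auto simp: Let_def)

lemma history_at_labels: "(v, b) \<in> set (history_at a X t) \<Longrightarrow> b = X v"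
  by (induction t) (auto simp: Let_def)

lemma history_at_examined:
  "(v, b) \<in> set (history_at a X t) \<Longrightarrow> \<exists>s\<ge>1. s \<le> t \<and> examined a X s = v"
proof (induction t)
  case (Suc t)
  show ?case
  proof (cases "(v, b) \<in> set (history_at a X t)")
    case True
    with Suc.IH show ?thesis by (meson le_SucI)
  next
    case False
    with Suc.prems have "examined a X (Suc t) = v" by (auto simp: examined_def Let_def)
    then show ?thesis by (intro exI[of _ "Suc t"]) auto
  qed
qed auto

text \<open>
  Seeing a given bit string is a condition on finitely many fixed labels: adaptivity disappears once
  the answers are prescribed.
\<close>

lemma bits_eq_iff_labels:
  "map snd (history_at a X (length bs)) = bs \<longleftrightarrow> (\<forall>(v, b) \<in> set (replay a bs). X v = b)"
proof (induction bs rule: rev_induct)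
  case (snoc b bs)
  show ?case
  proof (cases "map snd (history_at a X (length bs)) = bs")
    case True
    then have "history_at a X (length bs) = replay a bs"
      using history_at_eq_replay[of a X "length bs"] by simp
    with snoc True show ?thesis by (auto simp: Let_def)
  next
    case False
    with snoc show ?thesis by (auto simp: Let_def)
  qed
qed auto

lemma prob_space_label_measure: "prob_space (label_measure p)"
  unfolding label_measure_def by (intro prob_space_PiM prob_space_measure_pmf)

lemma space_label_measure [simp]: "space (label_measure p) = UNIV"
  by (auto simp: label_measure_def space_PiM)

lemma measurable_label [measurable]: "(\<lambda>X. X v) \<in> measurable (label_measure p) (count_space UNIV)"
proof -
  have "(\<lambda>X. X v) \<in> measurable (label_measure p) (measure_pmf (bernoulli_pmf p))"
    unfolding label_measure_def by (rule measurable_component_singleton) simp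
  then show ?thesis by (simp cong: measurable_cong_sets)
qed

lemma measurable_history_at [measurable]:
  "(\<lambda>X. history_at a X t) \<in> measurable (label_measure p) (count_space UNIV)"
proof (induction t)
  case (Suc t)
  have "(\<lambda>X. (\<lambda>h X. h @ [(a h, X (a h))]) (history_at a X t) X)
      \<in> measurable (label_measure p) (count_space UNIV)"
  proof (rule measurable_compose_countable[OF _ Suc])
    fix h :: history
    show "(\<lambda>X. h @ [(a h, X (a h))]) \<in> measurable (label_measure p) (count_space UNIV)"
      by (rule measurable_compose[OF measurable_label]) simp
  qed
  then show ?case by (simp add: Let_def)
qed simp

lemma prob_labels:
  assumes "distinct (map fst h)"
  shows "measure (label_measure (1/2)) {X. \<forall>(v, b) \<in> set h. X v = b} = (1/2) ^ length h"
proof -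
  interpret product_prob_space "\<lambda>_::vertex. measure_pmf (bernoulli_pmf (1/2))" UNIV
    by (intro product_prob_spaceI prob_space_measure_pmf)
  let ?m = "\<lambda>v. the (map_of h v)"
  have "{X. \<forall>(v, b) \<in> set h. X v = b}
      = {X \<in> space (label_measure (1/2)). \<forall>v\<in>fst ` set h. X v \<in> {?m v}}"
  proof -
    have "?m v = b" if "(v, b) \<in> set h" for v b
      using map_of_is_SomeI[OF assms that] by simp
    then show ?thesis by auto
  qed
  also have "measure (label_measure (1/2)) \<dots>
      = (\<Prod>v\<in>fst ` set h. measure (bernoulli_pmf (1/2)) {?m v})"
    using emeasure_PiM_Collect[of "fst ` set h" "\<lambda>v. {?m v}"]
    unfolding label_measure_def emeasure_eq_measure measure_pmf.emeasure_eq_measure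
    by (simp add: prod_ennreal measure_nonneg prod_nonneg)
  also have "\<dots> = (\<Prod>v\<in>fst ` set h. 1/2)"
  proof (rule prod.cong)
    fix v show "measure (bernoulli_pmf (1/2)) {?m v} = 1/2"
      by (cases "?m v") (auto simp: measure_pmf_single)
  qed simp
  also have "\<dots> = (1/2) ^ length h"
    using distinct_card[OF assms] by simp
  finally show ?thesis .
qed

lemma prob_bits:
  assumes "distinct (map fst (replay a bs))"
  shows "measure (label_measure (1/2)) {X. map snd (history_at a X (length bs)) = bs} = (1/2) ^ length bs"
  unfolding bits_eq_iff_labels using prob_labels[OF assms] by simp

lemma prob_bits_in_le:
  assumes "\<And>bs. distinct (map fst (replay a bs))"
    and "T \<subseteq> {bs. length bs = t}"
  shows "measure (label_measure (1/2)) {X. map snd (history_at a X t) \<in> T} \<le> card T / 2 ^ t"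
proof -
  interpret prob_space "label_measure (1/2)" by (rule prob_space_label_measure)
  have fin: "finite T"
    using finite_subset[OF assms(2)] finite_lists_length_eq[of "UNIV::bool set" t] by simp
  have "{X. map snd (history_at a X t) \<in> T} = (\<Union>bs\<in>T. {X. map snd (history_at a X t) = bs})" by auto
  also have "measure (label_measure (1/2)) \<dots>
      \<le> (\<Sum>bs\<in>T. measure (label_measure (1/2)) {X. map snd (history_at a X t) = bs})"
  proof (intro finite_measure_subadditive_finite fin image_subsetI)
    fix bs
    have "{X \<in> space (label_measure (1/2)). map snd (history_at a X t) = bs} \<in> events" by measurable
    then show "{X. map snd (history_at a X t) = bs} \<in> events" by simp
  qed
  also have "\<dots> = (\<Sum>bs\<in>T. (1/2) ^ t)"
    using assms(2) prob_bits[OF assms(1)] by (intro sum.cong) auto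
  finally show ?thesis by (simp add: power_divide)
qed

section \<open>Counting zeros on a path\<close>

lemma card_multiples:
  assumes "(m::nat) > 0"
  shows "card {i \<in> {1..n}. m dvd i} = n div m"
proof -
  have "{i \<in> {1..n}. m dvd i} = (\<lambda>j. j * m) ` {1..n div m}"
    using assms by (auto simp: dvd_def image_iff less_eq_div_iff_mult_less_eq mult.commute Suc_le_eq)
  moreover have "inj_on (\<lambda>j. j * m) {1..n div m}" using assms by (auto simp: inj_on_def)
  ultimately show ?thesis by (simp add: card_image)
qed

text \<open>
  A prefix is identified with its length, so that zeros are counted on an interval of natural numbers.
\<close>

lemma path_ones_add_zeros:
  "path_ones X v + card {i \<in> {1..length v}. \<not> X (take i v)} = length v"
proof -
  have "bij_betw (\<lambda>i. take i v) {1..length v} {w. w \<noteq> [] \<and> prefix w v}"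
    by (rule bij_betw_byWitness[where f' = length])
       (auto simp: take_is_prefix Suc_le_eq elim!: prefixE)
  then have "path_ones X v = (\<Sum>i\<in>{1..length v}. of_bool (X (take i v)))"
    unfolding path_ones_def by (rule sum.reindex_bij_betw[symmetric])
  also have "\<dots> = card {i \<in> {1..length v}. X (take i v)}"
    by (simp add: of_bool_def sum.If_cases Int_def)
  also have "\<dots> + card {i \<in> {1..length v}. \<not> X (take i v)} = card {1..length v}"
  proof -
    have "{1..length v} = {i \<in> {1..length v}. X (take i v)} \<union> {i \<in> {1..length v}. \<not> X (take i v)}"
      by auto
    then have "card {1..length v} = card ({i \<in> {1..length v}. X (take i v)} \<union> {i \<in> {1..length v}. \<not> X (take i v)})"
      by (rule arg_cong[where f = card])
    also have "\<dots> = card {i \<in> {1..length v}. X (take i v)} + card {i \<in> {1..length v}. \<not> X (take i v)}"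
      by (rule card_Un_disjoint) auto
    finally show ?thesis by simp
  qed
  finally show ?thesis by simp
qed

section \<open>The search\<close>

text \<open>
  \<open>M\<close> is the distance between levels with ignored labels. The depth-first search forgets its stack
  at the multiples of \<open>M * N\<close>; as these are multiples of \<open>M\<close>, a visited vertex at such a level always
  survives the label test.
\<close>

locale search_parameters =
  fixes M N :: nat
  assumes M_pos: "M > 0" and N_pos: "N > 0"
begin

abbreviation B :: nat where "B \<equiv> M * N"

lemma B_pos: "B > 0"
  using M_pos N_pos by simp

text \<open>
  A state consists of the number of restarts and the stack of vertices waiting to be visited. The head
  of the stack is visited next and \<open>x\<close> is its label. After a success at the end of a block and after a
  restart the search continues with one child of the vertex just visited, since no
  vertex below it has been visited before.
\<close>

fun step :: "nat \<times> vertex list \<Rightarrow> bool \<Rightarrow> nat \<times> vertex list" where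
  "step (f, v # vs) x =
     (if M dvd length v \<or> x
      then if B dvd length v then (f, [v @ [True]]) else (f, (v @ [False]) # (v @ [True]) # vs)
      else if vs = [] then (Suc f, [v @ [True]]) else (f, vs))"
| "step (f, []) x = (f, [])"

definition state :: "bool list \<Rightarrow> nat \<times> vertex list" where
  "state bs = foldl step (0, [[True]]) bs"

definition search :: strategy where
  "search h = hd (snd (state (map snd h)))"

lemma state_Nil [simp]: "state [] = (0, [[True]])"
  by (simp add: state_def)

lemma state_snoc [simp]: "state (bs @ [b]) = step (state bs) b"
  by (simp add: state_def)

lemma replay_search_snoc:
  "replay search (bs @ [b]) = replay search bs @ [(hd (snd (state bs)), b)]"
  by (simp add: search_def)

section \<open>Shape of the stack\<close>

text \<open>
  Block \<open>k\<close> consists of the depths from \<open>k * B + 1\<close> to \<open>(k + 1) * B\<close>: the search of the next block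
  starts with a child of a vertex at depth \<open>(k + 1) * B\<close>, and the smallest depth on the stack is \<open>1\<close>.
\<close>

definition in_block :: "nat \<Rightarrow> vertex list \<Rightarrow> bool" where
  "in_block k vs \<longleftrightarrow> (\<forall>v\<in>set vs. k * B < length v \<and> length v \<le> Suc k * B)"

fun block_of :: "vertex list \<Rightarrow> nat" where
  "block_of [] = 0"
| "block_of (v # vs) = (length v - 1) div B"

text \<open>
  The stack is sorted so that the top has the largest depth. Thus a win at the top is the best that
  the stack has to offer, which the drift estimate needs.
\<close>

definition well_shaped :: "nat \<times> vertex list \<Rightarrow> bool" where
  "well_shaped s \<longleftrightarrow> snd s \<noteq> [] \<and> in_block (block_of (snd s)) (snd s) \<and>
     sorted_wrt (\<lambda>v w. length w \<le> length v) (snd s)"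

lemma block_of_eq:
  assumes "k * B < length v" "length v \<le> Suc k * B"
  shows "block_of (v # vs) = k"
proof -
  have "k * B \<le> length v - 1" "length v - 1 < Suc k * B" using assms by linarith+
  then show ?thesis by (simp add: div_nat_eqI mult.commute)
qed

lemma well_shapedI:
  assumes "vs \<noteq> []" "in_block k vs" "sorted_wrt (\<lambda>v w. length w \<le> length v) vs"
  shows "well_shaped (f, vs)" "block_of vs = k"
proof -
  from assms obtain v ws where "vs = v # ws" by (cases vs) auto
  with assms(2) show "block_of vs = k" using block_of_eq[of k v ws] by (simp add: in_block_def)
  with assms show "well_shaped (f, vs)" by (simp add: well_shaped_def)
qed

lemma block_step:
  assumes "in_block k (v # vs)"
  shows "B dvd length v \<Longrightarrow> length v = Suc k * B \<and> in_block (Suc k) [v @ [True]]"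
    and "\<not> B dvd length v \<Longrightarrow> in_block k ((v @ [False]) # (v @ [True]) # vs) \<and> in_block k [v @ [True]]"
proof -
  have v: "k * B < length v" "length v \<le> Suc k * B" using assms by (auto simp: in_block_def)
  {
    assume "B dvd length v"
    then obtain j where j: "length v = j * B" by (auto simp: dvd_def mult.commute)
    then have "k < j" "j \<le> Suc k" using v B_pos by (auto simp del: mult_Suc)
    then have "j = Suc k" by simp
    then show "length v = Suc k * B \<and> in_block (Suc k) [v @ [True]]"
      using j M_pos N_pos by (auto simp: in_block_def Suc_le_eq)
  }
  assume "\<not> B dvd length v"
  then have "length v < Suc k * B" using v by (metis dvd_triv_right le_neq_implies_less)
  then show "in_block k ((v @ [False]) # (v @ [True]) # vs) \<and> in_block k [v @ [True]]"
    using assms by (auto simp: in_block_def)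
qed

lemma well_shaped_step:
  assumes "well_shaped s"
  shows "well_shaped (step s x)"
proof -
  obtain f v vs where s: "s = (f, v # vs)"
    using assms by (cases s; cases "snd s") (auto simp: well_shaped_def)
  define k where "k = block_of (v # vs)"
  have k: "in_block k (v # vs)" and sorted: "sorted_wrt (\<lambda>v w. length w \<le> length v) (v # vs)"
    using assms by (auto simp: s well_shaped_def k_def)
  have vs: "in_block k vs" using k by (simp add: in_block_def)
  show ?thesis
  proof (cases "B dvd length v")
    case True
    then have "M dvd length v" by (meson dvd_mult_left)
    then show ?thesis using block_step(1)[OF k True] True
      by (auto simp: s intro!: well_shapedI(1)[of _ "Suc k"])
  next
    case False
    then show ?thesis using block_step(2)[OF k False] vs sorted
      by (auto simp: s intro!: well_shapedI(1)[of _ k] le_SucI)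
  qed
qed

section \<open>The potential and its drift\<close>

text \<open>
  A lower bound for the probability that the tree of admissible descendants of a vertex at depth \<open>d\<close>,
  including the vertex itself, is infinite. The exact probabilities satisfy \<open>p = c (2 q - q\<^sup>2)\<close>, where
  \<open>q\<close> belongs to the next level and \<open>c\<close> is \<open>1\<close> or \<open>1/2\<close>. For \<open>c = 1/2\<close> this raises \<open>1/q\<close> by at
  most \<open>1\<close>, so it is enough to add \<open>1\<close> to the inverse at each level going up from a level divisible by
  \<open>M\<close>; after \<open>M - 1\<close> such steps the value \<open>M\<close> has grown to \<open>2 M - 1\<close>, and the level with \<open>c = 1\<close>
  brings it back to at most \<open>M\<close>.
\<close>

definition win :: "nat \<Rightarrow> real" where
  "win d = (if M dvd d then 1 / M else 1 / (2 * real M - real (d mod M)))"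

text \<open>
  The expected prize of the first winner on the stack, from the top, when vertices win independently
  with probability \<open>win\<close>. In block \<open>k\<close> the prize is the depth plus \<open>k * B\<close>, and the
  prize for having no winner is \<open>2 * k * B - B\<close>. The shift makes the highest prize of a block, the
  one at depth \<open>(k + 1) * B\<close>, equal to the lowest prize of the next block, so that nothing is lost when
  the stack is cleared. The gap of at least \<open>B\<close> between having a winner and having none pays for the
  restarts.
\<close>

primrec reward :: "nat \<Rightarrow> vertex list \<Rightarrow> real" where
  "reward k [] = 2 * (real k * B) - B"
| "reward k (v # vs) =
     win (length v) * (length v + real k * B) + (1 - win (length v)) * reward k vs"

definition potential :: "nat \<times> vertex list \<Rightarrow> real" where
  "potential s = reward (block_of (snd s)) (snd s) - N / 2 * real (fst s)"

lemma win_bounds: "1 / (2 * M) \<le> win d" "win d \<le> 1"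
proof -
  have "real (d mod M) \<le> real M" using M_pos by (simp add: less_imp_le)
  moreover have "real (d mod M) + 1 \<le> real M" using mod_less_divisor[OF M_pos, of d] by linarith
  ultimately show "1 / (2 * M) \<le> win d" "win d \<le> 1"
    using M_pos by (auto simp: win_def field_simps)
qed

text \<open>
  Where the label is ignored, one vertex is replaced by two with certainty. With \<open>b = 2 M - 1\<close> and
  \<open>M \<ge> 2\<close> this is \<open>2 / (b + 1) \<le> 2 / b - 1 / b\<^sup>2\<close>.
\<close>

lemma win_forced:
  assumes "M dvd d"
  shows "win d \<le> 2 * win (Suc d) - (win (Suc d))\<^sup>2"
proof (cases "M = 1")
  case False
  define b where "b = 2 * real M - 1"
  have b: "b \<ge> 3" "b + 1 = 2 * real M" using False M_pos by (auto simp: b_def)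
  have "Suc d mod M = 1"
    using assms False M_pos by (metis Suc_lessI less_one mod_Suc_eq mod_greater_zero_iff_not_dvd mod_less neq0_conv One_nat_def)
  then have "win (Suc d) = 1 / b" using False M_pos
    by (auto simp: win_def b_def dvd_eq_mod_eq_0)
  moreover have "win d = 2 / (b + 1)" using assms M_pos unfolding b(2) by (simp add: win_def)
  moreover have "2 / (b + 1) \<le> 2 * (1 / b) - (1 / b)\<^sup>2"
    using b(1) by (simp add: field_simps power2_eq_square)
  ultimately show ?thesis by simp
next
  case True
  then have "win j = 1" for j unfolding win_def by simp
  then show ?thesis by simp
qed

text \<open>
  Where the label counts, the two children are obtained with probability \<open>1/2\<close> only, whence the factor
  \<open>2\<close> on the left.
\<close>

lemma win_unforced:
  assumes "\<not> M dvd d"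
  shows "2 * win d \<le> 2 * win (Suc d) - (win (Suc d))\<^sup>2"
proof -
  define a where "a = 2 * real M - real (d mod M) - 1"
  have lt: "d mod M < M" using M_pos by simp
  then have "real (d mod M) + 1 \<le> M" by linarith
  then have a: "a \<ge> 1" using lt by (simp add: a_def)
  have "win d = 1 / (a + 1)" using assms by (simp add: win_def a_def)
  moreover have "win (Suc d) = 1 / a"
  proof (cases "Suc (d mod M) = M")
    case True
    then have "M dvd Suc d" by (simp add: dvd_eq_mod_eq_0 mod_Suc)
    moreover have "a = M" using True by (simp add: a_def)
    ultimately show ?thesis by (simp add: win_def)
  next
    case False
    then have "Suc d mod M = Suc (d mod M)" by (simp add: mod_Suc)
    then show ?thesis by (simp add: win_def a_def dvd_eq_mod_eq_0)
  qed
  moreover have "2 * (1 / (a + 1)) \<le> 2 * (1 / a) - (1 / a)\<^sup>2"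
    using a by (simp add: field_simps power2_eq_square)
  ultimately show ?thesis by simp
qed

lemma reward_bounds:
  assumes "in_block k vs"
  shows "reward k [] \<le> reward k vs"
    and "k * B \<le> l \<Longrightarrow> (\<And>v. v \<in> set vs \<Longrightarrow> length v \<le> l) \<Longrightarrow> reward k vs \<le> l + real k * B"
  using assms
proof (induction vs)
  case (Cons v vs)
  have w: "0 \<le> win (length v)" "win (length v) \<le> 1"
    using win_bounds[of "length v"] by (auto intro: order_trans[rotated])
  {
    case 1
    then have "in_block k vs" and len: "k * B < length v" by (auto simp: in_block_def)
    from len have "real k * B \<le> length v" by (metis less_imp_le of_nat_le_iff of_nat_mult)
    moreover have "0 \<le> real B" by (rule of_nat_0_le_iff)
    ultimately have "reward k [] \<le> length v + real k * B" unfolding reward.simps by linarith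
    with w Cons.IH(1)[OF \<open>in_block k vs\<close>] show ?case
      using convex_bound_le[of "- (length v + real k * B)" "- reward k []" "- reward k vs" "win (length v)" "1 - win (length v)"]
      by (simp add: algebra_simps)
  next
    case 2
    then have "reward k vs \<le> l + real k * B" by (intro Cons.IH(2)) (auto simp: in_block_def)
    moreover have "length v + real k * B \<le> l + real k * B" using 2 by simp
    ultimately show ?case unfolding reward.simps using w by (intro convex_bound_le) auto
  }
next
  case Nil
  {
    case 2
    then have "real k * B \<le> l" by (metis of_nat_le_iff of_nat_mult)
    moreover have "0 \<le> real B" by (rule of_nat_0_le_iff)
    ultimately show ?case unfolding reward.simps by linarith
  }
qed simp

text \<open>
  One lottery ticket is replaced by two: the winning probability does not drop below \<open>p\<close>, the prize rises
  from \<open>w\<close> to \<open>w + 1\<close>, and \<open>y\<close> is what the remaining stack is worth. Since \<open>y\<close> does not exceed the new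
  prize, a higher winning probability cannot hurt.
\<close>

lemma branch_gain:
  fixes p q w y :: real
  assumes "p \<le> 2 * q - q\<^sup>2" "y \<le> w + 1" "r \<le> p"
  shows "q * (w + 1) + (1 - q) * (q * (w + 1) + (1 - q) * y) \<ge> p * w + (1 - p) * y + r"
proof -
  have "p * (w + 1 - y) \<le> (2 * q - q\<^sup>2) * (w + 1 - y)"
    using assms by (intro mult_right_mono) auto
  with assms(3) show ?thesis by (simp add: algebra_simps power2_eq_square)
qed

text \<open>
  The three cases are the end of a block, an ignored label inside a block, and a label that counts.
  In the last case the dead branch leaves at least the worth \<open>y\<close> of the remaining stack, because a
  restart is worth at least as much as having no winner, its charge included.
\<close>

lemma potential_drift:
  assumes "well_shaped s"
  shows "potential (step s True) + potential (step s False) \<ge> 2 * (potential s + 1 / (2 * M))"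
proof -
  obtain f v vs where s: "s = (f, v # vs)"
    using assms by (cases s; cases "snd s") (auto simp: well_shaped_def)
  define k where "k = block_of (v # vs)"
  have k: "in_block k (v # vs)" and sorted: "sorted_wrt (\<lambda>v w. length w \<le> length v) (v # vs)"
    using assms by (auto simp: s well_shaped_def k_def)
  have vs: "in_block k vs" using k by (simp add: in_block_def)
  define d where "d = length v"
  define w where "w = d + real k * B"
  define y where "y = reward k vs"
  define \<kappa> where "\<kappa> = N / 2 * real f"
  have kd: "k * B < d" using k by (simp add: in_block_def d_def)
  then have kd': "real k * B \<le> d" by (metis less_imp_le of_nat_le_iff of_nat_mult)
  have y_lower: "2 * (real k * B) - B \<le> y" using reward_bounds(1)[OF vs] by (simp add: y_def)
  have y_upper: "y \<le> w"
    unfolding y_def w_def using kd sorted by (intro reward_bounds(2)[OF vs]) (auto simp: d_def)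
  have pot: "potential s = win d * w + (1 - win d) * y - \<kappa>"
    unfolding s potential_def by (simp add: k_def[symmetric] d_def w_def y_def \<kappa>_def del: block_of.simps)
  have split: "reward k ((v @ [False]) # (v @ [True]) # vs) =
      win (Suc d) * (w + 1) + (1 - win (Suc d)) * (win (Suc d) * (w + 1) + (1 - win (Suc d)) * y)"
    by (simp add: d_def w_def y_def algebra_simps)
  \<comment> \<open>A single fresh vertex beats the empty stack by more than the charge \<open>N / 2 = B / (2 * M)\<close>: its
    prize exceeds the one for no winner by at least \<open>B + 1\<close>, and it wins with probability at least
    \<open>1 / (2 * M)\<close>.\<close>
  have restart: "reward j [v @ [True]] \<ge> reward j [] + N / 2 + 1 / (2 * M)"
    if "in_block j [v @ [True]]" for j
  proof -
    have "j * B < Suc d" using that by (simp add: in_block_def d_def)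
    then have "real (j * B) \<le> real d" by (simp only: of_nat_le_iff less_Suc_eq_le)
    then have "1 / (2 * M) * (1 + B) \<le> win (Suc d) * (Suc d - real j * B + B)"
      using win_bounds(1)[of "Suc d"] by (intro mult_mono) (auto intro: order_trans[rotated])
    moreover have "1 / (2 * M) * (1 + real B) = N / 2 + 1 / (2 * M)"
      using M_pos by (simp add: field_simps)
    ultimately show ?thesis by (simp add: d_def algebra_simps)
  qed
  note simps = s potential_def
  consider "B dvd d" | "M dvd d" "\<not> B dvd d" | "\<not> M dvd d" "\<not> B dvd d"
    by blast
  then show ?thesis
  proof cases
    case 1
    have M: "M dvd d" using 1 by (meson dvd_mult_left)
    have d: "d = Suc k * B" and blk: "in_block (Suc k) [v @ [True]]"
      using block_step(1)[OF k] 1 by (auto simp: d_def)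
    have "block_of [v @ [True]] = Suc k" using well_shapedI(2)[OF _ blk] by simp
    then have st: "potential (step s x) = reward (Suc k) [v @ [True]] - \<kappa>" for x
      using 1 M by (simp add: simps d_def \<kappa>_def del: block_of.simps reward.simps)
    have "win d * w + (1 - win d) * y \<le> w"
      using y_upper win_bounds[of d] by (intro convex_bound_le) (auto intro: order_trans[rotated])
    also have "w = reward (Suc k) []" by (simp add: w_def d algebra_simps)
    finally show ?thesis using restart[OF blk] unfolding st pot by simp
  next
    case 2
    have blk: "in_block k ((v @ [False]) # (v @ [True]) # vs)"
      using block_step(2)[OF k] 2 by (auto simp: d_def)
    have "block_of ((v @ [False]) # (v @ [True]) # vs) = k"
      using well_shapedI(2)[OF _ blk] sorted by (auto intro: le_SucI)
    then have st: "potential (step s x) = reward k ((v @ [False]) # (v @ [True]) # vs) - \<kappa>" for x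
      using 2 by (simp add: simps d_def \<kappa>_def del: block_of.simps reward.simps)
    have "y \<le> w + 1" using y_upper by simp
    from branch_gain[OF win_forced[OF 2(1)] this win_bounds(1)[of d]]
    have "potential s + \<kappa> + 1 / (2 * M) \<le> potential (step s x) + \<kappa>" for x
      unfolding st split pot by simp
    then show ?thesis using add_mono[of "potential s + \<kappa> + 1 / (2 * M)" "potential (step s True) + \<kappa>"
        "potential s + \<kappa> + 1 / (2 * M)" "potential (step s False) + \<kappa>"] by simp
  next
    case 3
    have blk: "in_block k ((v @ [False]) # (v @ [True]) # vs)" and blk': "in_block k [v @ [True]]"
      using block_step(2)[OF k] 3 by (auto simp: d_def)
    have "block_of ((v @ [False]) # (v @ [True]) # vs) = k"
      using well_shapedI(2)[OF _ blk] sorted by (auto intro: le_SucI)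
    then have alive: "potential (step s True) = reward k ((v @ [False]) # (v @ [True]) # vs) - \<kappa>"
      using 3 by (simp add: simps d_def \<kappa>_def del: block_of.simps reward.simps)
    have dead: "potential (step s False) \<ge> y - \<kappa>"
    proof (cases "vs = []")
      case True
      have "block_of [v @ [True]] = k" using well_shapedI(2)[OF _ blk'] by simp
      then have "potential (step s False) = reward k [v @ [True]] - N / 2 - \<kappa>"
        using 3 True by (simp add: simps d_def \<kappa>_def algebra_simps add_divide_distrib del: block_of.simps reward.simps)
      moreover have "0 \<le> 1 / real (2 * M)" by simp
      ultimately show ?thesis using restart[OF blk'] unfolding y_def True by linarith
    next
      case False
      have "block_of vs = k" using well_shapedI(2)[OF False vs] sorted by simp
      then show ?thesis using 3 False
        by (simp add: simps d_def \<kappa>_def y_def)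
    qed
    have "1 / (2 * M) * 2 \<le> 2 * win d" using win_bounds(1)[of d] by simp
    then show ?thesis
      using branch_gain[OF win_unforced[OF 3(1)], of y w "1 / (2 * M) * 2"] y_upper dead
      unfolding alive split pot by (simp add: algebra_simps)
  qed
qed

text \<open>
  Within a block the reward ranges over an interval of length \<open>2 * B\<close>. A step leads at most to the
  next block, whose interval begins \<open>2 * B\<close> higher, and adds at most one restart at the charge
  \<open>N / 2 \<le> B\<close>.
\<close>

lemma potential_bounded_step:
  assumes "well_shaped s"
  shows "\<bar>potential (step s x) - potential s\<bar> \<le> 4 * B"
proof -
  obtain f v vs where s: "s = (f, v # vs)"
    using assms by (cases s; cases "snd s") (auto simp: well_shaped_def)
  define k where "k = block_of (v # vs)"
  have range: "reward j [] \<le> reward j ws \<and> reward j ws \<le> reward j [] + 2 * B" if "in_block j ws" for j ws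
    using reward_bounds(1)[OF that] reward_bounds(2)[OF that, of "Suc j * B"] that
    by (auto simp: in_block_def algebra_simps)
  have k: "in_block k (v # vs)" using assms by (auto simp: s well_shaped_def k_def)
  define s' where "s' = step s x"
  have ws': "well_shaped s'" using well_shaped_step[OF assms] by (simp add: s'_def)
  define j where "j = block_of (snd s')"
  have j: "in_block j (snd s')" using ws' by (auto simp: well_shaped_def j_def)
  have "\<exists>u\<in>set (snd s'). u \<in> {v @ [True]} \<union> set vs"
    using ws' by (cases vs) (auto simp: s'_def s well_shaped_def split: if_splits)
  then obtain u where u: "u \<in> set (snd s')" "u = v @ [True] \<or> u \<in> set vs" by auto
  have "j = k \<or> j = Suc k"
  proof -
    have "k * B < length u" "length u \<le> Suc k * B + 1" using u k by (auto simp: in_block_def)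
    moreover have "j * B < length u" "length u \<le> Suc j * B" using u j by (auto simp: in_block_def)
    ultimately have "k * B < Suc j * B" "j * B \<le> Suc k * B" by linarith+
    then show ?thesis using B_pos by (auto simp del: mult_Suc)
  qed
  then have "reward j [] = reward k [] \<or> reward j [] = reward k [] + 2 * B"
    by (auto simp: algebra_simps)
  moreover have "fst s' = f \<or> fst s' = Suc f" by (auto simp: s'_def s)
  then have "N / 2 * real (fst s') = N / 2 * real f \<or> N / 2 * real (fst s') = N / 2 * real f + N / 2"
    by (auto simp: algebra_simps)
  moreover have "real N \<le> B" using M_pos by (simp del: of_nat_mult)
  moreover have "potential s' = reward j (snd s') - N / 2 * real (fst s')"
    by (simp add: potential_def j_def)
  moreover have "potential s = reward k (v # vs) - N / 2 * real f"
    by (simp add: potential_def k_def s)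
  ultimately show ?thesis
    using range[OF k] range[OF j] unfolding s'_def by linarith
qed

text \<open>
  Every prize at depth at most \<open>d\<close> is at most \<open>2 * d\<close>, because the block starts above depth \<open>d\<close>.
\<close>

lemma potential_le:
  assumes "well_shaped s"
  shows "potential s \<le> 2 * length (hd (snd s)) - N / 2 * real (fst s)"
proof -
  obtain f v vs where s: "s = (f, v # vs)"
    using assms by (cases s; cases "snd s") (auto simp: well_shaped_def)
  define k where "k = block_of (v # vs)"
  have k: "in_block k (v # vs)" and sorted: "sorted_wrt (\<lambda>v w. length w \<le> length v) (v # vs)"
    using assms by (auto simp: s well_shaped_def k_def)
  have kv: "k * B < length v" using k by (simp add: in_block_def)
  then have "reward k (v # vs) \<le> length v + real k * B"
    using sorted by (intro reward_bounds(2)[OF k]) auto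
  moreover have "real (k * B) \<le> length v" using kv by (simp only: of_nat_le_iff)
  ultimately show ?thesis by (simp add: potential_def s k_def del: reward.simps block_of.simps)
qed

section \<open>Freshness and the zeros on the path\<close>

text \<open>
  The zeros strictly above \<open>w\<close> at levels where the label counts. Each of them was passed by
  a restart.
\<close>

definition defect :: "history \<Rightarrow> vertex \<Rightarrow> nat" where
  "defect h w = card {i. 0 < i \<and> i < length w \<and> \<not> M dvd i \<and> (take i w, False) \<in> set h}"

text \<open>
  The subtrees below the waiting vertices are pairwise disjoint and entirely unvisited, which is why no
  vertex is visited twice. All proper ancestors of a waiting vertex, apart from the root, have been
  visited, so the path to its parent is found.
\<close>

definition search_inv :: "history \<Rightarrow> nat \<times> vertex list \<Rightarrow> bool" where
  "search_inv h s \<longleftrightarrow> snd s \<noteq> [] \<and> sorted_wrt (\<parallel>) (snd s) \<and>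
     (\<forall>w\<in>set (snd s). w \<noteq> [] \<and> length w \<le> Suc (length h) \<and> (\<forall>u\<in>fst ` set h. \<not> prefix w u)
        \<and> (\<forall>i. 0 < i \<and> i < length w \<longrightarrow> take i w \<in> fst ` set h) \<and> defect h w \<le> fst s)"

lemma search_inv_step:
  assumes inv: "search_inv h s" and h': "h' = h @ [(hd (snd s), x)]"
  shows "search_inv h' (step s x)"
proof -
  obtain f v vs where s: "s = (f, v # vs)"
    using inv by (cases s; cases "snd s") (auto simp: search_inv_def)
  have set_h': "set h' = insert (v, x) (set h)" by (simp add: h' s)
  have par: "v \<parallel> w" if "w \<in> set vs" for w using inv that by (auto simp: search_inv_def s)
  have sorted: "sorted_wrt (\<parallel>) vs" using inv by (auto simp: search_inv_def s)
  have v: "v \<noteq> []" "length v \<le> Suc (length h)" "\<And>u. u\<in>fst ` set h \<Longrightarrow> \<not> prefix v u"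
    "\<And>i. 0 < i \<Longrightarrow> i < length v \<Longrightarrow> take i v \<in> fst ` set h" "defect h v \<le> f"
    using inv by (auto simp: search_inv_def s)
  have rest: "w \<noteq> [] \<and> length w \<le> Suc (length h') \<and> (\<forall>u\<in>fst ` set h'. \<not> prefix w u)
        \<and> (\<forall>i. 0 < i \<and> i < length w \<longrightarrow> take i w \<in> fst ` set h') \<and> defect h' w \<le> f"
    if w: "w \<in> set vs" for w
  proof -
    have "take i w \<noteq> v" for i using par[OF w] take_is_prefix[of i w] by auto
    then have "defect h' w = defect h w" by (auto simp: defect_def set_h' intro!: arg_cong[where f = card])
    moreover have "\<not> prefix w v" using par[OF w] by auto
    ultimately show ?thesis using inv w by (auto simp: search_inv_def s set_h' h')
  qed
  have child_take: "take i (v @ [b]) = take i v" if "i \<le> length v" for i b using that by simp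
  have child: "v @ [b] \<noteq> [] \<and> length (v @ [b]) \<le> Suc (length h') \<and> (\<forall>u\<in>fst ` set h'. \<not> prefix (v @ [b]) u)
        \<and> (\<forall>i. 0 < i \<and> i < length (v @ [b]) \<longrightarrow> take i (v @ [b]) \<in> fst ` set h')" for b
  proof (intro conjI allI impI ballI)
    fix u assume "u \<in> fst ` set h'"
    then show "\<not> prefix (v @ [b]) u" using v(3) by (auto simp: set_h' dest: append_prefixD)
  next
    fix i assume "0 < i \<and> i < length (v @ [b])"
    then show "take i (v @ [b]) \<in> fst ` set h'"
      using v(4)[of i] by (cases "i = length v") (auto simp: set_h')
  qed (use v in \<open>auto simp: h'\<close>)
  let ?D = "{i. 0 < i \<and> i < length v \<and> \<not> M dvd i \<and> (take i v, False) \<in> set h}"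
  let ?D' = "\<lambda>b. {i. 0 < i \<and> i < length (v @ [b]) \<and> \<not> M dvd i \<and> (take i (v @ [b]), False) \<in> set h'}"
  have fin: "finite ?D" by simp
  have sub: "?D' b \<subseteq> insert (length v) ?D" for b
    by (auto simp: set_h' less_Suc_eq)
  have defect_Suc: "defect h' (v @ [b]) \<le> Suc f" for b
  proof -
    have "card (?D' b) \<le> card (insert (length v) ?D)" by (rule card_mono[OF _ sub]) simp
    also have "\<dots> \<le> Suc (card ?D)" by (rule card_insert_le_m1) simp_all
    finally show ?thesis using v(5) by (simp add: defect_def)
  qed
  have defect_alive: "defect h' (v @ [b]) \<le> f" if "M dvd length v \<or> x" for b
  proof -
    have "(v, False) \<notin> set h" using v(3) by force
    then have "?D' b \<subseteq> ?D"
      using sub[of b] that by (auto simp: set_h' less_Suc_eq)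
    then have "card (?D' b) \<le> card ?D" by (rule card_mono[OF fin])
    then show ?thesis using v(5) by (simp add: defect_def)
  qed
  have par_child: "v @ [b] \<parallel> w" if "w \<in> set vs" for b w
    using par[OF that] by (auto simp: parallel_def dest: append_prefixD)
  have siblings: "v @ [False] \<parallel> v @ [True]" by (simp add: parallel_def)
  show ?thesis
    unfolding search_inv_def s
    using rest child defect_Suc defect_alive par_child siblings sorted
    by (auto simp del: prefix_snoc length_append)
qed

lemma search_inv: "search_inv (replay search bs) (state bs)"
proof (induction bs rule: rev_induct)
  case Nil
  then show ?case by (auto simp: search_inv_def defect_def)
next
  case (snoc b bs)
  show ?case unfolding state_snoc by (rule search_inv_step[OF snoc replay_search_snoc])
qed

lemma well_shaped_state: "well_shaped (state bs)"
proof (induction bs rule: rev_induct)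
  case Nil
  have "in_block 0 [[True]]" using B_pos by (auto simp: in_block_def)
  then show ?case using well_shapedI(1)[of "[[True]]" 0 0] by simp
next
  case (snoc b bs)
  then show ?case by (simp add: well_shaped_step)
qed

lemma distinct_search: "distinct (map fst (replay search bs))"
proof (induction bs rule: rev_induct)
  case (snoc b bs)
  have "hd (snd (state bs)) \<notin> fst ` set (replay search bs)"
    using search_inv[of bs] hd_in_set[of "snd (state bs)"] prefix_order.refl
    unfolding search_inv_def by blast
  with snoc show ?case unfolding replay_search_snoc by simp
qed simp

section \<open>High probability and the time bound\<close>

text \<open>
  The potential is at most twice the depth minus \<open>N/2\<close> per restart. As it is at least
  \<open>t / (8 M) \<ge> 2 (n + 1)\<close>, the search has passed depth \<open>n\<close>; as the depth is at most \<open>t + 1\<close>,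
  there have been at most \<open>4 (t + 1) / N\<close> restarts. The path to depth \<open>n\<close> along the top of the stack then has at most one zero for each multiple
  of \<open>M\<close> and one for each restart.
\<close>

lemma search_success:
  fixes X :: labelling
  assumes n: "16 * M * (n + 1) \<le> t"
    and pot: "potential (state (map snd (history_at search X t))) \<ge> t / (8 * M)"
    and t: "real t \<le> \<tau>"
  shows "\<exists>v. length v = n \<and> path_found_by search X v \<tau>
           \<and> n - n / M - 4 * (real t + 1) / N \<le> path_ones X v"
proof -
  define h where "h = history_at search X t"
  define s where "s = state (map snd h)"
  have h: "replay search (map snd h) = h" using history_at_eq_replay[of search X t] by (simp add: h_def)
  have inv: "search_inv h s" using search_inv[of "map snd h"] by (simp add: s_def h)
  define w where "w = hd (snd s)"
  define f where "f = fst s"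
  have "w \<in> set (snd s)" using inv by (auto simp: w_def search_inv_def)
  then have len: "length w \<le> Suc t"
    and exam: "\<And>i. 0 < i \<Longrightarrow> i < length w \<Longrightarrow> take i w \<in> fst ` set h" and defect: "defect h w \<le> f"
    using inv by (auto simp: search_inv_def f_def h_def)
  define r where "r = t / (8 * M)"
  define z where "z = N / 2 * real f"
  have "r \<le> 2 * real (length w) - z"
    using pot potential_le[OF well_shaped_state, of "map snd h"]
    by (simp add: w_def f_def s_def h_def r_def z_def)
  moreover have "2 * (real n + 1) \<le> r"
  proof -
    have "real (16 * M * (n + 1)) \<le> real t" using n by (simp only: of_nat_le_iff)
    then show ?thesis using M_pos by (simp add: r_def field_simps)
  qed
  moreover have "0 \<le> z" "0 \<le> real n" by (simp_all add: z_def)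
  ultimately have bound: "2 * (real n + 1) + z \<le> 2 * real (length w)" and z: "0 \<le> z"
    by simp_all
  from bound z have "real n + 1 \<le> real (length w)" by simp
  then have "n < length w" by simp
  from bound have "N / 2 * real f \<le> 2 * real (length w)" by (simp add: z_def)
  also have "\<dots> \<le> 2 * (real t + 1)" using len by simp
  finally have "N / 2 * real f \<le> 2 * (real t + 1)" .
  then have f: "real f \<le> 4 * (real t + 1) / N" using N_pos by (simp add: field_simps)
  define v where "v = take n w"
  have v: "length v = n" using \<open>n < length w\<close> by (simp add: v_def)
  have take_v: "take i v = take i w" if "i \<le> n" for i using that by (simp add: v_def)
  have found: "path_found_by search X v \<tau>"
    unfolding path_found_by_def
  proof (intro allI impI)
    fix u assume u: "u \<noteq> [] \<and> prefix u v"
    then have "u = take (length u) w" "length u \<le> n"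
      using take_v[of "length u"] v prefix_length_le[of u v] by (auto simp: prefix_def)
    then have "u \<in> fst ` set h" using exam[of "length u"] u \<open>n < length w\<close> by auto
    then obtain b where "(u, b) \<in> set (history_at search X t)" by (auto simp: h_def)
    from history_at_examined[OF this] t show "\<exists>r\<ge>1. real r \<le> \<tau> \<and> examined search X r = u" by force
  qed
  let ?Z = "{i \<in> {1..n}. \<not> X (take i v)}"
  let ?D = "{i. 0 < i \<and> i < length w \<and> \<not> M dvd i \<and> (take i w, False) \<in> set h}"
  have "?Z \<subseteq> {i \<in> {1..n}. M dvd i} \<union> ?D"
  proof
    fix i assume i: "i \<in> ?Z"
    then obtain b where "(take i w, b) \<in> set h" using exam[of i] \<open>n < length w\<close> by force
    moreover then have "\<not> b" using history_at_labels[of "take i w" b search X t] i take_v[of i] by (simp add: h_def)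
    ultimately show "i \<in> {i \<in> {1..n}. M dvd i} \<union> ?D" using i \<open>n < length w\<close> by auto
  qed
  then have "card ?Z \<le> card ({i \<in> {1..n}. M dvd i} \<union> ?D)" by (rule card_mono[rotated]) simp
  also have "\<dots> \<le> card {i \<in> {1..n}. M dvd i} + card ?D" by (rule card_Un_le)
  also have "\<dots> \<le> n div M + f"
    using defect card_multiples[OF M_pos, of n] by (simp add: defect_def)
  finally have "real (card ?Z) \<le> real (n div M) + real f" by linarith
  moreover have "real (n div M) \<le> n / M" by (rule of_nat_div_le_of_nat)
  ultimately have "real (card ?Z) \<le> n / M + 4 * (real t + 1) / N" using f by linarith
  then show ?thesis using found v path_ones_add_zeros[of X v] by (intro exI[of _ v]) (auto simp: algebra_simps)
qed

lemma potential_tail: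
  obtains a c where "a > 0" "c > 0" and "\<And>t.
    real (card {bs. length bs = t \<and> potential (state bs) < t / (8 * M)}) / 2 ^ t \<le> a * exp (- c * t)"
proof -
  have ws: "well_shaped (0, [[True]])" using well_shaped_state[of "[]"] by simp
  have "1 / (2 * real M) \<le> 1" using M_pos by simp
  also have "1 \<le> real (4 * B)" using B_pos by (simp only: real_of_nat_ge_one_iff)
  finally have le: "1 / real (2 * M) \<le> real (4 * B)" by simp
  have pos: "0 < 1 / real (2 * M)" using M_pos by simp
  obtain a c where "a > 0" "c > 0" and ac: "\<And>t. real (card {bs. length bs = t \<and>
      potential (foldl step (0, [[True]]) bs) < 1 / real (2 * M) / 4 * t}) / 2 ^ t \<le> a * exp (- c * t)"
    by (rule drift_lower_tail[of well_shaped step potential "1 / real (2 * M)" "real (4 * B)" "(0, [[True]])"])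
      (use well_shaped_step potential_drift potential_bounded_step le pos ws in auto)
  moreover have "1 / real (2 * M) / 4 * t = t / (8 * M)" for t :: nat by simp
  ultimately show thesis using that[of a c] by (simp add: state_def)
qed

end

text \<open>
  Needed because the success probability is a measure of this event and would vanish by convention if
  the event were not measurable.
\<close>

lemma measurable_success:
  "{X. \<exists>v. length v = n \<and> real (path_ones X v) \<ge> c \<and> path_found_by a X v \<tau>} \<in> sets (label_measure p)"
proof -
  have [measurable]: "(\<lambda>X. real (path_ones X v)) \<in> borel_measurable (label_measure p)" for v
  proof -
    have "(\<lambda>X. real (path_ones X v)) = (\<lambda>X. \<Sum>w | w \<noteq> [] \<and> prefix w v. if X w then 1 else 0)"
      by (auto simp: path_ones_def of_bool_def intro!: sum.cong)
    then show ?thesis by simp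
  qed
  have [measurable]: "(\<lambda>X. examined a X t) \<in> measurable (label_measure p) (count_space UNIV)" for t
    unfolding examined_def by (rule measurable_compose[OF measurable_history_at]) simp
  have "{X \<in> space (label_measure p). \<exists>v. length v = n \<and> real (path_ones X v) \<ge> c \<and>
      (\<forall>w. w \<noteq> [] \<and> prefix w v \<longrightarrow> (\<exists>t\<ge>1. real t \<le> \<tau> \<and> examined a X t = w))} \<in> sets (label_measure p)"
    by measurable
  then show ?thesis by (simp add: path_found_by_def)
qed

text \<open>
  A strategy that ignores its seed makes the success event a rectangle in the product space.
\<close>

lemma success_probability_deterministic:
  assumes "prob_space R"
  shows "success_probability p R (\<lambda>_. a) \<epsilon> n \<tau> = measure (label_measure p)
     {X. \<exists>v. length v = n \<and> real (path_ones X v) \<ge> (1 - \<epsilon>) * real n \<and> path_found_by a X v \<tau>}"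
proof -
  interpret R: prob_space R by fact
  interpret L: prob_space "label_measure p" by (rule prob_space_label_measure)
  let ?E = "{X. \<exists>v. length v = n \<and> real (path_ones X v) \<ge> (1 - \<epsilon>) * real n \<and> path_found_by a X v \<tau>}"
  have "success_probability p R (\<lambda>_. a) \<epsilon> n \<tau> = measure (R \<Otimes>\<^sub>M label_measure p) (space R \<times> ?E)"
    unfolding success_probability_def by (rule arg_cong[where f = "measure _"]) (auto simp: space_pair_measure)
  also have "\<dots> = measure (label_measure p) ?E"
  proof -
    have "emeasure (R \<Otimes>\<^sub>M label_measure p) (space R \<times> ?E)
        = emeasure R (space R) * emeasure (label_measure p) ?E"
      by (rule L.emeasure_pair_measure_Times[OF sets.top measurable_success])
    then show ?thesis by (simp add: measure_def R.emeasure_space_1)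
  qed
  finally show ?thesis .
qed

theorem corollary3p2:
  "\<exists>C::real. C > 0 \<and>
     (\<forall>\<epsilon>::real. 0 < \<epsilon> \<and> \<epsilon> < 1 \<longrightarrow>
       (\<exists>(R :: real measure) (A :: real \<Rightarrow> strategy). search_algorithm R A \<and>
          (\<lambda>n. success_probability (1/2) R A \<epsilon> n (C * real n / \<epsilon>)) \<longlonglongrightarrow> 1))"
proof (intro exI[of _ 100] conjI allI impI)
  fix \<epsilon> :: real
  assume "0 < \<epsilon> \<and> \<epsilon> < 1"
  then have \<epsilon>: "0 < \<epsilon>" "\<epsilon> < 1" by auto
  \<comment> \<open>The zeros at multiples of \<open>M\<close> and those due to restarts each take half of the allowance \<open>\<epsilon> * n\<close>.
    The restarts number at most \<open>4 * (t + 1) / N\<close> with \<open>t + 1 \<le> 101 * n / \<epsilon>\<close>, and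
    \<open>808 = 2 * 4 * 101\<close>. The time \<open>100 * n / \<epsilon>\<close> leaves room for
    \<open>16 * M * (n + 1) \<le> 96 * n / \<epsilon>\<close>.\<close>
  define M where "M = nat \<lceil>2 / \<epsilon>\<rceil>"
  define N where "N = nat \<lceil>808 / \<epsilon>\<^sup>2\<rceil>"
  have M: "2 / \<epsilon> \<le> M" "M \<le> 3 / \<epsilon>"
  proof -
    show "2 / \<epsilon> \<le> M" by (simp add: M_def real_nat_ceiling_ge)
    have "0 \<le> 2 / \<epsilon>" using \<epsilon> by simp
    then have "real M \<le> 2 / \<epsilon> + 1" unfolding M_def by linarith
    also have "\<dots> \<le> 3 / \<epsilon>" using \<epsilon> by (simp add: field_simps)
    finally show "M \<le> 3 / \<epsilon>" .
  qed
  have N: "808 / \<epsilon>\<^sup>2 \<le> N" by (simp add: N_def real_nat_ceiling_ge)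
  have "0 < 2 / \<epsilon>" "0 < 808 / \<epsilon>\<^sup>2" using \<epsilon> by simp_all
  with M(1) N have "0 < real M" "0 < real N" by linarith+
  then interpret search_parameters M N by unfold_locales simp_all
  let ?R = "return borel (0::real)"
  have R: "prob_space ?R" by (rule prob_space_return) simp
  interpret L: prob_space "label_measure (1/2)" by (rule prob_space_label_measure)
  let ?p = "\<lambda>n. success_probability (1/2) ?R (\<lambda>_. search) \<epsilon> n (100 * real n / \<epsilon>)"
  obtain a c where a: "a > 0" and c: "c > 0" and tail: "\<And>t.
      real (card {bs. length bs = t \<and> potential (state bs) < t / (8 * M)}) / 2 ^ t \<le> a * exp (- c * t)"
    by (rule potential_tail) blast
  have lower: "1 - a * exp (- c * n) \<le> ?p n" if "n \<ge> 1" for n :: nat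
  proof -
    let ?E = "{X. \<exists>v. length v = n \<and> real (path_ones X v) \<ge> (1 - \<epsilon>) * real n
                  \<and> path_found_by search X v (100 * real n / \<epsilon>)}"
    define t where "t = nat \<lfloor>100 * real n / \<epsilon>\<rfloor>"
    let ?T = "{bs. length bs = t \<and> potential (state bs) < t / (8 * M)}"
    let ?F = "{X. map snd (history_at search X t) \<in> ?T}"
    have n\<epsilon>: "real n / \<epsilon> \<ge> real n" using \<epsilon> by (simp add: le_divide_eq mult_left_le)
    have t_upper: "real t \<le> 100 * real n / \<epsilon>" using \<epsilon> by (simp add: t_def)
    have t_lower: "100 * real n / \<epsilon> - 1 \<le> real t" unfolding t_def by linarith
    have nt: "real n \<le> real t"
    proof -
      have "100 * real n - 1 \<le> real t" using t_lower n\<epsilon> by simp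
      then show ?thesis using that by linarith
    qed
    have "16 * M * (n + 1) \<le> t"
    proof -
      have "16 * M * (real n + 1) \<le> 16 * (3 / \<epsilon>) * (real n + real n)"
        using M(2) that \<epsilon> by (intro mult_mono) auto
      also have "\<dots> = 96 * (real n / \<epsilon>)" by simp
      also have "\<dots> \<le> t" using t_lower n\<epsilon> that by simp
      finally have "real (16 * M * (n + 1)) \<le> real t" by (simp add: algebra_simps)
      then show ?thesis by (simp only: of_nat_le_iff)
    qed
    have loss: "n / M + 4 * (real t + 1) / N \<le> \<epsilon> * n"
    proof -
      have "n / M \<le> n / (2 / \<epsilon>)" using M(1) \<epsilon> by (intro frac_le) auto
      then have "n / M \<le> \<epsilon> * n / 2" by (simp add: mult.commute)
      moreover have "4 * (real t + 1) / N \<le> (4 * 101 * (real n / \<epsilon>)) / (808 / \<epsilon>\<^sup>2)"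
        using N t_upper n\<epsilon> that \<epsilon> by (intro frac_le) auto
      moreover have "(4 * 101 * (real n / \<epsilon>)) / (808 / \<epsilon>\<^sup>2) = \<epsilon> * n / 2"
        using \<epsilon> by (simp add: field_simps power2_eq_square)
      ultimately show ?thesis by linarith
    qed
    have sub: "UNIV - ?F \<subseteq> ?E"
    proof
      fix X assume "X \<in> UNIV - ?F"
      then have "potential (state (map snd (history_at search X t))) \<ge> t / (8 * M)" by auto
      from search_success[OF \<open>16 * M * (n + 1) \<le> t\<close> this t_upper]
      obtain v where "length v = n" "path_found_by search X v (100 * real n / \<epsilon>)"
        "n - n / M - 4 * (real t + 1) / N \<le> path_ones X v" by blast
      then show "X \<in> ?E" using loss by (auto simp: algebra_simps)
    qed
    have F: "?F \<in> L.events"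
    proof -
      have "{X \<in> space (label_measure (1/2)). map snd (history_at search X t) \<in> ?T} \<in> L.events"
        by measurable
      then show ?thesis by simp
    qed
    have "L.prob ?F \<le> card ?T / 2 ^ t"
      by (rule prob_bits_in_le[OF distinct_search]) auto
    also have "\<dots> \<le> a * exp (- c * t)" by (rule tail)
    also have "\<dots> \<le> a * exp (- c * n)" using a c nt by simp
    finally have "1 - a * exp (- c * n) \<le> L.prob (UNIV - ?F)"
      using L.prob_compl[OF F] by simp
    also have "\<dots> \<le> L.prob ?E"
      by (rule L.finite_measure_mono[OF sub measurable_success])
    finally show ?thesis by (simp add: success_probability_deterministic[OF R])
  qed
  have "(\<lambda>n::nat. 1 - a * exp (- c * n)) \<longlonglongrightarrow> 1"
    using c by real_asymp
  moreover have "?p n \<le> 1" for n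
    unfolding success_probability_deterministic[OF R] by (rule L.prob_le_1)
  ultimately have "?p \<longlonglongrightarrow> 1"
    using lower by (intro real_tendsto_sandwich[of "\<lambda>n. 1 - a * exp (- c * n)" ?p _ "\<lambda>_. 1"])
      (auto intro: eventually_sequentiallyI[of 1])
  moreover have "search_algorithm ?R (\<lambda>_. search)"
    using R by (simp add: search_algorithm_def)
  ultimately show "\<exists>(R :: real measure) A. search_algorithm R A \<and>
      (\<lambda>n. success_probability (1/2) R A \<epsilon> n (100 * real n / \<epsilon>)) \<longlonglongrightarrow> 1" by blast
qed simp

end
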